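(* Let $k$ be a field and $p$ a prime different from $\operatorname{char}k$. Assume $k^*\neq (k^* )^p$, and, if $\mu_p\subset k$, assume that $k^*/(k^* )^p$ is not cyclic. Then for every finite cyclic extension $K/k$ and every $s\in\mathbb{N}$ there exists $a\in k^*$ such that $x^{p^s}-a$ is irreducible over $K$.
   Context: $k^*$ is the multiplicative group of $k$, $(k^* )^p$ the subgroup of $p$-th powers. $\mu_p\subset k$ means $k$ contains all $p$-th roots of unity of its algebraic closure. *)

theory Defs
  imports "HOL-Algebra.Algebraic_Closure_Type"
begin

text \<open>A field extension K/k is given by a field embedding of k into K.\<close>
definition field_emb :: "('k::field \<Rightarrow> 'K::field) \<Rightarrow> bool" where
  "field_emb \<phi> \<longleftrightarrow> \<phi> 1 = 1 \<and> (\<forall>x y. \<phi> (x + y) = \<phi> x + \<phi> y) \<and> (\<forall>x y. \<phi> (x * y) = \<phi> x * \<phi> y)"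

definition ext_scale :: "('k::field \<Rightarrow> 'K::field) \<Rightarrow> 'k \<Rightarrow> 'K \<Rightarrow> 'K" where
  "ext_scale \<phi> a x = \<phi> a * x"

definition ext_finite :: "('k::field \<Rightarrow> 'K::field) \<Rightarrow> bool" where
  "ext_finite \<phi> \<longleftrightarrow> (\<exists>B. finite B \<and> module.span (ext_scale \<phi>) B = UNIV)"

definition ext_degree :: "('k::field \<Rightarrow> 'K::field) \<Rightarrow> nat" where
  "ext_degree \<phi> = vector_space.dim (ext_scale \<phi>) UNIV"

definition ext_auts :: "('k::field \<Rightarrow> 'K::field) \<Rightarrow> ('K \<Rightarrow> 'K) set" where
  "ext_auts \<phi> = {\<sigma>. bij \<sigma> \<and> (\<forall>x y. \<sigma> (x + y) = \<sigma> x + \<sigma> y) \<and> (\<forall>x y. \<sigma> (x * y) = \<sigma> x * \<sigma> y)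
                   \<and> (\<forall>a. \<sigma> (\<phi> a) = \<phi> a)}"

text \<open>Finite Galois extension: finite, and |Aut(K/k)| = [K:k].
      Cyclic: moreover Aut(K/k) is generated by one automorphism.\<close>
definition finite_cyclic_ext :: "('k::field \<Rightarrow> 'K::field) \<Rightarrow> bool" where
  "finite_cyclic_ext \<phi> \<longleftrightarrow> field_emb \<phi> \<and> ext_finite \<phi> \<and> card (ext_auts \<phi>) = ext_degree \<phi>
     \<and> (\<exists>\<tau>\<in>ext_auts \<phi>. ext_auts \<phi> = range (\<lambda>n::nat. \<tau> ^^ n))"

definition nontrivial_pth_powers :: "nat \<Rightarrow> 'k::field itself \<Rightarrow> bool" where
  "nontrivial_pth_powers p _ \<longleftrightarrow> (\<exists>a::'k. a \<noteq> 0 \<and> \<not> (\<exists>b. a = b ^ p))"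

definition pth_power_quotient_cyclic :: "nat \<Rightarrow> 'k::field itself \<Rightarrow> bool" where
  "pth_power_quotient_cyclic p _ \<longleftrightarrow>
     (\<exists>g::'k. g \<noteq> 0 \<and> (\<forall>a. a \<noteq> 0 \<longrightarrow> (\<exists>n::nat. \<exists>b. b \<noteq> 0 \<and> a = g ^ n * b ^ p)))"

definition roots_of_unity_in :: "nat \<Rightarrow> 'k::field itself \<Rightarrow> bool" where
  "roots_of_unity_in p _ \<longleftrightarrow> (\<forall>z :: 'k alg_closure. z ^ p = 1 \<longrightarrow> z \<in> range to_ac)"

end

theory Submission
  imports Defs "HOL-Library.Function_Algebras"
begin

text \<open>
  By Capelli's criterion, \<open>x ^ (p ^ s) - a\<close> is irreducible over \<open>K\<close> as soon as \<open>a\<close> is not a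
  \<open>p\<close>-th power in \<open>K\<close> and, for \<open>p = 2\<close>, not of the form \<open>- 4 * c ^ 4\<close>. So it suffices to find
  such an \<open>a\<close> in the base field. Let \<open>\<tau>\<close> generate the Galois group. If \<open>\<alpha> ^ p = a\<close> lies in the base
  field, then \<open>\<tau> \<alpha> / \<alpha>\<close> is a \<open>p\<close>-th root of unity, and it determines \<open>a\<close> modulo \<open>p\<close>-th powers of
  the base field; hence the classes that become \<open>p\<close>-th powers in \<open>K\<close> form a cyclic group. If the
  \<open>p\<close>-th roots of unity are not in the base field, this group is even trivial, because \<open>\<tau>\<close>
  then fixes some \<open>p\<close>-th root of \<open>a\<close>.
\<close>

section \<open>Radicals over a subfield containing the roots of unity\<close>

text \<open>By Bezout, for \<open>k\<close> prime to \<open>p\<close> the element \<open>z\<close>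
  is determined by \<open>z ^ k\<close> and \<open>z ^ p\<close>, and would be 1; so
  \<open>z\<close> has exact order \<open>p\<close>.\<close>

lemma root_of_unity_power_eq_1_iff:
  fixes z :: "'a::field"
  assumes "prime p" "z ^ p = 1" "z \<noteq> 1"
  shows "z ^ k = 1 \<longleftrightarrow> p dvd k"
proof
  assume k: "z ^ k = 1"
  show "p dvd k"
  proof (rule ccontr)
    assume "\<not> p dvd k"
    then have "coprime p k"
      using assms(1) by (simp add: prime_imp_coprime)
    moreover have "k \<noteq> 0"
      using \<open>\<not> p dvd k\<close> by (metis dvd_0_right)
    ultimately obtain x y where "k * x = p * y + 1"
      using bezout_nat[of k p] by (metis coprime_commute coprime_iff_gcd_eq_1)
    then have "z ^ (k * x) = z ^ (p * y) * z"
      by simp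
    then show False
      using k assms by (simp add: power_mult)
  qed
qed (use assms in \<open>auto simp: power_mult\<close>)

lemma monom_pcompose: "monom a k \<circ>\<^sub>p q = smult a (q ^ k)"
  by (induction k) (simp_all add: monom_0 monom_Suc pcompose_pCons mult.commute)

text \<open>Carries statements about \<open>\<alpha>\<close> over to \<open>\<alpha> ^ p\<close>.
  The coefficient formula keeps \<open>h\<close> over the same subfield as \<open>f\<close>.\<close>

lemma pcompose_monom_of_coeff_multiples:
  fixes f :: "'a::comm_ring_1 poly"
  assumes "p > 0" and "\<And>k. \<not> p dvd k \<Longrightarrow> coeff f k = 0"
  obtains h where "f = h \<circ>\<^sub>p monom 1 p" "\<And>k. coeff h k = coeff f (p * k)"
proof
  define h where "h = (\<Sum>k\<le>degree f. monom (coeff f (p * k)) k)"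
  have le: "k \<le> p * k" for k
    using assms(1) by simp
  have "coeff f (p * k) = 0" if "degree f < k" for k
    using less_le_trans[OF that le] by (rule coeff_eq_0)
  then show "coeff h k = coeff f (p * k)" for k
    by (simp add: h_def coeff_sum not_le)
  have "coeff (h \<circ>\<^sub>p monom 1 p) k = coeff f k" for k
  proof -
    have "coeff (h \<circ>\<^sub>p monom 1 p) k = (\<Sum>i\<le>degree f. if p * i = k then coeff f k else 0)"
      by (auto simp: h_def pcompose_sum monom_pcompose monom_power smult_monom coeff_sum mult.commute
          intro!: sum.cong)
    also have "\<dots> = coeff f k"
    proof (cases "p dvd k \<and> k \<le> degree f")
      case True
      then obtain j where k: "k = p * j" by auto
      then have "j \<le> degree f"
        using True le[of j] by linarith
      have "(\<Sum>i\<le>degree f. if p * i = k then coeff f k else 0) = (\<Sum>i\<le>degree f. if i = j then coeff f k else 0)"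
        using assms(1) k by (intro sum.cong) auto
      also have "\<dots> = coeff f k"
        using \<open>j \<le> degree f\<close> by simp
      finally show ?thesis .
    next
      case False
      then have "coeff f k = 0"
        using assms(2) coeff_eq_0[of f k] by force
      then show ?thesis
        by (simp cong: if_cong)
    qed
    finally show ?thesis .
  qed
  then show "f = h \<circ>\<^sub>p monom 1 p"
    by (simp add: poly_eq_iff)
qed

section \<open>Polynomials over a subfield: division and minimal polynomials\<close>

definition polys_over :: "'a::zero set \<Rightarrow> 'a poly set" where
  "polys_over F = {f. \<forall>i. coeff f i \<in> F}"

text \<open>Subfields are modelled as sets so that the base field and its extension by a square root
  of -1 both live inside one algebraic closure.\<close>

locale field_subset =
  fixes F :: "'a::field set"
  assumes one_closed: "1 \<in> F"
    and diff_closed: "x \<in> F \<Longrightarrow> y \<in> F \<Longrightarrow> x - y \<in> F"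
    and mult_closed: "x \<in> F \<Longrightarrow> y \<in> F \<Longrightarrow> x * y \<in> F"
    and inverse_closed: "x \<in> F \<Longrightarrow> inverse x \<in> F"
begin

lemma zero_closed: "0 \<in> F"
  using diff_closed[OF one_closed one_closed] by simp

lemma uminus_closed: "x \<in> F \<Longrightarrow> - x \<in> F"
  using diff_closed[OF zero_closed, of x] by simp

lemma add_closed: "x \<in> F \<Longrightarrow> y \<in> F \<Longrightarrow> x + y \<in> F"
  using diff_closed[of x "- y"] uminus_closed[of y] by simp

lemma power_closed: "x \<in> F \<Longrightarrow> x ^ n \<in> F"
  by (induction n) (auto intro: one_closed mult_closed)

lemma divide_closed: "x \<in> F \<Longrightarrow> y \<in> F \<Longrightarrow> x / y \<in> F"
  by (simp add: divide_inverse mult_closed inverse_closed)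

lemma polys_over_diff: "f \<in> polys_over F \<Longrightarrow> g \<in> polys_over F \<Longrightarrow> f - g \<in> polys_over F"
  by (simp add: polys_over_def diff_closed)

lemma polys_over_add: "f \<in> polys_over F \<Longrightarrow> g \<in> polys_over F \<Longrightarrow> f + g \<in> polys_over F"
  by (simp add: polys_over_def add_closed)

lemma polys_over_mult: "f \<in> polys_over F \<Longrightarrow> g \<in> polys_over F \<Longrightarrow> f * g \<in> polys_over F"
  unfolding polys_over_def
  by (auto intro!: coeff_mult_semiring_closed zero_closed add_closed mult_closed)

lemma polys_over_monom: "a \<in> F \<Longrightarrow> monom a n \<in> polys_over F"
  by (simp add: polys_over_def zero_closed)

lemma polys_over_prod: "(\<And>i. i \<in> A \<Longrightarrow> f i \<in> polys_over F) \<Longrightarrow> prod f A \<in> polys_over F"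
  using polys_over_monom[OF one_closed, of 0]
  by (induction A rule: infinite_finite_induct) (simp_all add: polys_over_mult)

lemma polys_over_const: "a \<in> F \<Longrightarrow> [:a:] \<in> polys_over F"
  using polys_over_monom[of a 0] by (simp add: monom_0)

lemma polys_over_smult: "a \<in> F \<Longrightarrow> f \<in> polys_over F \<Longrightarrow> smult a f \<in> polys_over F"
  by (simp add: polys_over_def mult_closed)

lemma polys_over_scale: "a \<in> F \<Longrightarrow> f \<in> polys_over F \<Longrightarrow> f \<circ>\<^sub>p [:0, a:] \<in> polys_over F"
  by (simp add: polys_over_def coeff_pcompose_linear mult_closed power_closed)

lemma polys_over_division:
  assumes "f \<in> polys_over F" "g \<in> polys_over F" "g \<noteq> 0"
  shows "\<exists>s\<in>polys_over F. \<exists>r\<in>polys_over F. f = s * g + r \<and> (r = 0 \<or> degree r < degree g)"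
  using assms(1)
proof (induction "degree f" arbitrary: f rule: less_induct)
  case less
  show ?case
  proof (cases "f = 0 \<or> degree f < degree g")
    case True
    then show ?thesis
      using less.prems by (intro bexI[of _ 0] bexI[of _ f]) (auto simp: polys_over_def zero_closed)
  next
    case False
    define m where "m = monom (lead_coeff f / lead_coeff g) (degree f - degree g)"
    have m: "m \<in> polys_over F"
      unfolding m_def using less.prems assms(2)
      by (intro polys_over_monom divide_closed) (auto simp: polys_over_def)
    have "degree (m * g) \<le> degree f"
      using False degree_mult_le[of m g] degree_monom_le[of _ "degree f - degree g"]
      unfolding m_def by (meson add_le_mono1 le_diff_conv2 le_trans not_less_iff_gr_or_eq order.refl not_le)
    moreover have "coeff (m * g) (degree f) = lead_coeff f"
      using False assms(3) by (simp add: m_def coeff_monom_mult)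
    ultimately have d: "f - m * g = 0 \<or> degree (f - m * g) < degree f"
      by (intro eq_zero_or_degree_less degree_diff_le) auto
    have o: "f - m * g \<in> polys_over F"
      by (intro polys_over_diff polys_over_mult m assms less.prems)
    show ?thesis
    proof (cases "f - m * g = 0")
      case True
      then show ?thesis
        using m by (intro bexI[of _ m] bexI[of _ 0]) (auto simp: polys_over_def zero_closed)
    next
      case False
      then obtain s r where "s \<in> polys_over F" "r \<in> polys_over F" "f - m * g = s * g + r"
        "r = 0 \<or> degree r < degree g"
        using less.hyps[OF _ o] d by blast
      then show ?thesis
        using m by (intro bexI[of _ "s + m"] bexI[of _ r]) (auto simp: algebra_simps polys_over_add)
    qed
  qed
qed

text \<open>Normalise a nonzero annihilating polynomial of least degree. The remainder of any other
  one modulo \<open>f\<close> still annihilates \<open>\<alpha>\<close>, so by minimality it is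
  0.\<close>

lemma minimal_polynomial_over:
  assumes "q \<in> polys_over F" "q \<noteq> 0" "poly q \<alpha> = 0"
  obtains f where "f \<in> polys_over F" "lead_coeff f = 1" "poly f \<alpha> = 0"
    "\<And>g. g \<in> polys_over F \<Longrightarrow> g \<noteq> 0 \<Longrightarrow> poly g \<alpha> = 0 \<Longrightarrow> degree f \<le> degree g"
    "\<And>g. g \<in> polys_over F \<Longrightarrow> poly g \<alpha> = 0 \<Longrightarrow> \<exists>s\<in>polys_over F. g = s * f"
proof -
  define S where "S = {g \<in> polys_over F. g \<noteq> 0 \<and> poly g \<alpha> = 0}"
  have "q \<in> S"
    using assms by (simp add: S_def)
  then obtain h where h: "h \<in> S" "\<And>g. g \<in> S \<Longrightarrow> degree h \<le> degree g"
    using ex_has_least_nat[of "\<lambda>g. g \<in> S" q degree] by blast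
  define f where "f = smult (inverse (lead_coeff h)) h"
  have f: "f \<in> polys_over F" "lead_coeff f = 1" "poly f \<alpha> = 0" "f \<noteq> 0" "degree f = degree h"
    using h(1) by (auto simp: f_def S_def intro!: polys_over_smult inverse_closed)
       (simp add: polys_over_def)
  show ?thesis
  proof (rule that[of f])
    show le: "degree f \<le> degree g" if "g \<in> polys_over F" "g \<noteq> 0" "poly g \<alpha> = 0" for g
      using h(2)[of g] that f(5) by (simp add: S_def)
    show "\<exists>s\<in>polys_over F. g = s * f" if g: "g \<in> polys_over F" "poly g \<alpha> = 0" for g
    proof -
      obtain s r where sr: "s \<in> polys_over F" "r \<in> polys_over F" "g = s * f + r"
        "r = 0 \<or> degree r < degree f"
        using polys_over_division[OF g(1) f(1,4)] by blast
      then have "poly r \<alpha> = 0"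
        using g f by simp
      then have "r = 0"
        using le[of r] sr(2,4) leD by blast
      then show ?thesis
        using sr by auto
    qed
  qed (use f in auto)
qed

text \<open>
  Let \<open>f\<close> be the minimal polynomial of \<open>\<alpha>\<close>. The product \<open>P\<close> of all \<open>f (\<zeta> ^ i * x)\<close> is a polynomial in \<open>x ^ p\<close>,
  so the induction hypothesis for \<open>\<alpha> ^ p\<close> bounds the degree of \<open>f\<close> from below. If the bound were not improved by
  a factor \<open>p\<close>, then \<open>P\<close> would be \<open>x ^ (p ^ (r + 1)) - c\<close> up to sign, and comparing constant terms would
  exhibit \<open>c\<close> or \<open>- c\<close> as a \<open>p\<close>-th power.
\<close>

lemma degree_ge_of_radical:
  assumes p: "prime p" and \<zeta>: "\<zeta> \<in> F" "\<zeta> ^ p = 1" "\<zeta> \<noteq> 1"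
    and c: "c \<in> F" "\<forall>d\<in>F. d ^ p \<noteq> c"
    and "p = 2 \<longrightarrow> 2 \<le> r \<longrightarrow> (\<forall>d\<in>F. d ^ 2 \<noteq> - c)"
    and "\<alpha> ^ p ^ r = c" and "q \<in> polys_over F" "q \<noteq> 0" "poly q \<alpha> = 0"
  shows "p ^ r \<le> degree q"
  using assms(7-)
proof (induction r arbitrary: \<alpha> q)
  case 0
  then have "degree q \<noteq> 0"
    by (metis degree_eq_zeroE mult_zero_right pCons_0_0 poly_const_conv)
  then show ?case by simp
next
  case (Suc r)
  define n where "n = p ^ r"
  have "p > 0" "n > 0"
    using p by (auto simp: n_def prime_gt_0_nat)
  have IH: "n \<le> degree h" if "h \<in> polys_over F" "h \<noteq> 0" "poly h (\<alpha> ^ p) = 0" for h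
    unfolding n_def using Suc.prems(1,2) that by (intro Suc.IH) (auto simp: power_mult)
  have \<alpha>c: "\<alpha> ^ (p * n) = c"
    using Suc.prems by (simp add: n_def)
  have "\<alpha> \<noteq> 0"
    using c(2) zero_closed \<alpha>c \<open>p > 0\<close> \<open>n > 0\<close> by (auto simp: power_0_left)
  show ?case
  proof (rule ccontr)
    assume "\<not> ?case"
    then have q: "degree q < p * n"
      by (simp add: n_def)
    obtain f where f: "f \<in> polys_over F" "lead_coeff f = 1" "poly f \<alpha> = 0"
      and f_min: "\<And>g. g \<in> polys_over F \<Longrightarrow> g \<noteq> 0 \<Longrightarrow> poly g \<alpha> = 0 \<Longrightarrow> degree f \<le> degree g"
      and f_dvd: "\<And>g. g \<in> polys_over F \<Longrightarrow> poly g \<alpha> = 0 \<Longrightarrow> \<exists>s\<in>polys_over F. g = s * f"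
      using minimal_polynomial_over[OF Suc.prems(3-)] by metis
    have f_nz: "f \<noteq> 0"
      using f(2) by auto
    have deg_f: "degree f < p * n"
      using f_min[OF Suc.prems(3-)] q by simp
    \<comment> \<open>Otherwise \<open>f\<close> divided by \<open>x\<close> would annihilate
      \<open>\<alpha>\<close> as well, with smaller degree.\<close>
    have f0: "coeff f 0 \<noteq> 0"
    proof
      assume "coeff f 0 = 0"
      then obtain g where g: "f = pCons 0 g"
        by (cases f) auto
      then have "g \<noteq> 0" "poly g \<alpha> = 0" "degree f = Suc (degree g)"
        using f_nz f(3) \<open>\<alpha> \<noteq> 0\<close> by auto
      moreover have "g \<in> polys_over F"
        using f(1) unfolding polys_over_def g by (auto simp: coeff_pCons split: nat.splits)
      ultimately show False
        using f_min[of g] by simp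
    qed
    define fz where "fz i = f \<circ>\<^sub>p [:0, \<zeta> ^ i:]" for i
    have "\<zeta> \<noteq> 0"
      using \<zeta>(2) \<open>p > 0\<close> by (auto simp: power_0_left)
    have fz: "fz i \<in> polys_over F" "degree (fz i) = degree f" "fz i \<noteq> 0"
      "coeff (fz i) k = \<zeta> ^ (i * k) * coeff f k" "poly (fz i) x = poly f (\<zeta> ^ i * x)" for i k x
      using f(1) f_nz \<open>\<zeta> \<noteq> 0\<close> \<zeta>(1)
      by (auto simp: fz_def polys_over_scale power_closed degree_pcompose coeff_pcompose_linear
           poly_pcompose power_mult pcompose_eq_0_iff mult.commute)
    \<comment> \<open>Otherwise minimality makes \<open>fz i\<close> a constant multiple of
      \<open>f\<close>, and the constant terms show that the constant is 1. Then only exponents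
      divisible by \<open>p\<close> occur in \<open>f\<close>, and \<open>IH\<close> forces its
      degree up to \<open>p * n\<close>.\<close>
    have nz: "poly f (\<zeta> ^ i * \<alpha>) \<noteq> 0" if i: "\<not> p dvd i" for i
    proof
      assume "poly f (\<zeta> ^ i * \<alpha>) = 0"
      then obtain s where s: "fz i = s * f"
        using f_dvd[of "fz i"] fz(1,5) by auto
      then have "s \<noteq> 0"
        using fz(3)[of i] by auto
      then have "degree s = 0"
        using fz(2)[of i] f_nz s by (simp add: degree_mult_eq)
      then obtain e where "s = [:e:]"
        by (rule degree_eq_zeroE)
      then have e: "\<zeta> ^ (i * k) * coeff f k = e * coeff f k" for k
        using s fz(4)[of i k] by auto
      then have "e = 1"
        using e[of 0] f0 by simp
      have "coeff f k = 0" if "\<not> p dvd k" for k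
        using e[of k] root_of_unity_power_eq_1_iff[OF p \<zeta>(2,3), of "i * k"] i that p \<open>e = 1\<close>
        by (auto simp: prime_dvd_mult_iff)
      then obtain h where h: "f = h \<circ>\<^sub>p monom 1 p" "\<And>k. coeff h k = coeff f (p * k)"
        using pcompose_monom_of_coeff_multiples[OF \<open>p > 0\<close>, of f] by metis
      have "h \<in> polys_over F" "h \<noteq> 0" "poly h (\<alpha> ^ p) = 0"
        using f(1,3) h f_nz by (auto simp: polys_over_def poly_pcompose poly_monom)
      then have "n \<le> degree h"
        by (rule IH)
      then have "p * n \<le> degree f"
        unfolding h(1) by (simp add: degree_pcompose degree_monom_eq mult.commute)
      then show False
        using deg_f by simp
    qed
    define G where "G = monom 1 (p * n) - [:c:]"
    have G: "G \<in> polys_over F"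
      unfolding G_def by (intro polys_over_diff polys_over_monom polys_over_const one_closed c)
    have root: "poly G (\<zeta> ^ i * \<alpha>) = 0" for i
      using \<zeta>(2) by (simp add: G_def poly_monom power_mult_distrib \<alpha>c flip: power_mult)
        (simp add: power_mult mult.commute[of i] mult.assoc)
    \<comment> \<open>The factors are split off from \<open>G\<close> one by one:
      \<open>\<zeta> ^ (p - m) * \<alpha>\<close> is a root of \<open>G\<close> but, by
      \<open>nz\<close>, of no earlier factor, hence of the cofactor \<open>s\<close>. Rescaling the
      variable turns this into divisibility by \<open>fz m\<close>.\<close>
    have "\<exists>s\<in>polys_over F. G = s * (\<Prod>i<m. fz i)" if "m \<le> p" for m
      using that
    proof (induction m)
      case 0
      then show ?case using G by auto
    next
      case (Suc m)
      then obtain s where s: "s \<in> polys_over F" "G = s * (\<Prod>i<m. fz i)"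
        by auto
      define y where "y = \<zeta> ^ (p - m)"
      have "poly (fz i) (y * \<alpha>) \<noteq> 0" if "i < m" for i
      proof -
        have "\<not> p dvd i + (p - m)"
          using that Suc.prems by (intro nat_dvd_not_less) auto
        then show ?thesis
          using nz[of "i + (p - m)"] by (simp add: fz(5) y_def power_add mult.assoc)
      qed
      then have "poly s (y * \<alpha>) = 0"
        using root[of "p - m"] s(2) by (auto simp: y_def poly_prod)
      then obtain t where t: "t \<in> polys_over F" "s \<circ>\<^sub>p [:0, y:] = t * f"
        using f_dvd[of "s \<circ>\<^sub>p [:0, y:]"] s(1) \<zeta>(1)
        by (auto simp: y_def poly_pcompose polys_over_scale power_closed mult.commute)
      have "y * \<zeta> ^ m = 1"
        using Suc.prems \<zeta>(2) by (simp add: y_def flip: power_add)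
      then have "s = s \<circ>\<^sub>p ([:0, y:] \<circ>\<^sub>p [:0, \<zeta> ^ m:])"
        by (simp add: pcompose_pCons mult.commute)
      also have "\<dots> = (t \<circ>\<^sub>p [:0, \<zeta> ^ m:]) * fz m"
        by (simp only: pcompose_assoc t pcompose_mult fz_def)
      finally have "G = (t \<circ>\<^sub>p [:0, \<zeta> ^ m:]) * (\<Prod>i<Suc m. fz i)"
        using s(2) by (simp add: mult_ac)
      then show ?case
        using t(1) \<zeta>(1) by (auto intro!: bexI[of _ "t \<circ>\<^sub>p [:0, \<zeta> ^ m:]"] polys_over_scale power_closed)
    qed
    then obtain s where s: "G = s * (\<Prod>i<p. fz i)"
      by blast
    define P where "P = (\<Prod>i<p. fz i)"
    have deg_P: "degree P = p * degree f"
      using fz(2,3) by (simp add: P_def degree_prod_eq_sum_degree)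
    have "P \<noteq> 0"
      using fz(3) by (simp add: P_def)
    have deg_G: "degree G = p * n" and lc_G: "lead_coeff G = 1"
    proof -
      show "degree G = p * n"
        unfolding G_def using \<open>p > 0\<close> \<open>n > 0\<close>
        by (subst diff_conv_add_uminus, subst degree_add_eq_left) (auto simp: degree_monom_eq)
      then show "lead_coeff G = 1"
        using \<open>p > 0\<close> \<open>n > 0\<close> by (simp add: G_def coeff_pCons split: nat.splits)
    qed
    have "s \<noteq> 0"
      using s lc_G by auto
    then have deg_s: "p * n = degree s + p * degree f"
      using deg_G deg_P s \<open>P \<noteq> 0\<close> by (simp add: P_def[symmetric] degree_mult_eq)
    \<comment> \<open>Scaling \<open>x\<close> by \<open>\<zeta>\<close> permutes the factors of
      \<open>P\<close> cyclically, because \<open>\<zeta> ^ p = 1\<close>.\<close>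
    have shift: "P \<circ>\<^sub>p [:0, \<zeta>:] = P"
    proof -
      have "fz i \<circ>\<^sub>p [:0, \<zeta>:] = fz (Suc i)" for i
        by (simp add: fz_def pcompose_assoc[symmetric] pcompose_pCons mult.commute)
      then have "P \<circ>\<^sub>p [:0, \<zeta>:] = (\<Prod>i<p. fz (Suc i))"
        by (simp add: P_def pcompose_prod)
      moreover have "fz 0 * (\<Prod>i<p. fz (Suc i)) = fz p * P"
        by (simp add: P_def mult.commute flip: prod.lessThan_Suc_shift)
      moreover have "fz p = fz 0"
        using \<zeta>(2) by (simp add: fz_def)
      ultimately show ?thesis
        using fz(3)[of 0] by simp
    qed
    have "coeff P k = 0" if "\<not> p dvd k" for k
      using arg_cong[OF shift, of "\<lambda>h. coeff h k"] that root_of_unity_power_eq_1_iff[OF p \<zeta>(2,3), of k]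
      by (simp add: coeff_pcompose_linear)
    then obtain h where h: "P = h \<circ>\<^sub>p monom 1 p" "\<And>k. coeff h k = coeff P (p * k)"
      using pcompose_monom_of_coeff_multiples[OF \<open>p > 0\<close>, of P] by metis
    have "P \<in> polys_over F"
      unfolding P_def by (intro polys_over_prod fz(1))
    then have "h \<in> polys_over F"
      by (simp add: polys_over_def h(2))
    moreover have "h \<noteq> 0"
      using \<open>P \<noteq> 0\<close> h(1) by auto
    moreover have "poly P \<alpha> = 0"
      using \<open>p > 0\<close> f(3) by (auto simp: P_def poly_prod fz(5) intro!: bexI[of _ 0])
    then have "poly h (\<alpha> ^ p) = 0"
      by (simp add: h(1) poly_pcompose poly_monom)
    ultimately have "n \<le> degree h"
      by (rule IH)
    moreover have "degree P = p * degree h"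
      unfolding h(1) by (simp add: degree_pcompose degree_monom_eq mult.commute)
    then have "degree h = degree f"
      using deg_P \<open>p > 0\<close> by simp
    \<comment> \<open>\<open>IH\<close> bounds \<open>degree f\<close> below by \<open>n\<close> and
      \<open>deg_s\<close> bounds it above, so the cofactor \<open>s\<close> is constant.\<close>
    ultimately have "p * n \<le> p * degree f"
      by simp
    then have "degree s = 0" "degree f = n"
      using deg_s \<open>p > 0\<close> by auto
    then obtain e where e: "G = smult e P"
      using s by (auto simp: P_def elim!: degree_eq_zeroE)
    have "lead_coeff P = (\<Prod>i<p. \<zeta> ^ (i * n))"
      using f(2) by (simp add: P_def lead_coeff_prod fz(2,4) \<open>degree f = n\<close>)
    also have "\<dots> = \<zeta> ^ (n * (\<Sum>i<p. i))"
      by (simp add: power_sum sum_distrib_left mult.commute)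
    finally have e1: "e * \<zeta> ^ (n * (\<Sum>i<p. i)) = 1"
      using lc_G unfolding e by (cases "e = 0") auto
    have "coeff G 0 = - c"
      using \<open>p > 0\<close> \<open>n > 0\<close> by (simp add: G_def)
    then have e0: "e * coeff f 0 ^ p = - c"
      by (simp add: e P_def fz(5) flip: poly_0_coeff_0) (simp add: poly_prod fz(5))
    have f0F: "coeff f 0 \<in> F"
      using f(1) by (simp add: polys_over_def)
    show False
    proof (cases "p = 2")
      case True
      then have "(\<zeta> - 1) * (\<zeta> + 1) = 0"
        using \<zeta>(2) by (simp add: algebra_simps power2_eq_square)
      then have "\<zeta> = -1"
        using \<zeta>(3) by (auto simp: eq_neg_iff_add_eq_0)
      have "e * (- 1) ^ n = 1"
        using e1 by (simp add: True \<open>\<zeta> = -1\<close> numeral_2_eq_2)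
      \<comment> \<open>For \<open>r = 0\<close> the exponent \<open>n\<close> is 1, so
        \<open>e\<close> is -1 and \<open>c\<close> is a square. Otherwise \<open>n\<close> is even,
        so \<open>e = 1\<close> and \<open>- c\<close> is a square, which is excluded since
        \<open>2 \<le> Suc r\<close>.\<close>
      show False
      proof (cases "r = 0")
        case True
        then have "coeff f 0 ^ p = c"
          using e0 \<open>e * (- 1) ^ n = 1\<close> by (simp add: n_def) (metis minus_minus mult_minus1 minus_equation_iff)
        then show False
          using c f0F by auto
      next
        case False
        then have "e = 1"
          using \<open>e * (- 1) ^ n = 1\<close> \<open>p = 2\<close> by (simp add: n_def)
        then show False
          using e0 Suc.prems(1) f0F \<open>p = 2\<close> False by auto
      qed
    next
      case False
      then have "odd p"
        using p prime_odd_nat prime_ge_2_nat[OF p] by force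
      \<comment> \<open>An odd \<open>p\<close> divides the sum of the \<open>i < p\<close>, so the
        power of \<open>\<zeta>\<close> in \<open>e1\<close> is 1 and hence
        \<open>e = 1\<close>.\<close>
      have "2 * (\<Sum>i<p. i) = p * (p - 1)"
        using gauss_sum_nat[of "p - 1"] \<open>p > 0\<close> \<open>odd p\<close>
        by (simp add: lessThan_Suc_atMost[symmetric] atLeast0AtMost mult.commute)
      then have "p dvd 2 * (\<Sum>i<p. i)"
        by simp
      then have "p dvd n * (\<Sum>i<p. i)"
        using p False primes_dvd_imp_eq[OF p two_is_prime_nat] by (auto simp: prime_dvd_mult_iff)
      then have "\<zeta> ^ (n * (\<Sum>i<p. i)) = 1"
        using root_of_unity_power_eq_1_iff[OF p \<zeta>(2,3)] by blast
      then have "e = 1"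
        using e1 by simp
      then have "(- coeff f 0) ^ p = c"
        using e0 \<open>odd p\<close> by simp
      then show False
        using c f0F uminus_closed by blast
    qed
  qed
qed

end

section \<open>Irreducible binomials\<close>

text \<open>The degrees of two factors add up to \<open>degree f\<close>, so if one has full degree,
  the other is constant. The degree bounds below are meant for this.\<close>

lemma irreducible_if_no_small_factor:
  fixes f :: "'a::field poly"
  assumes "degree f > 0" and "\<And>h. h dvd f \<Longrightarrow> degree h > 0 \<Longrightarrow> degree f \<le> degree h"
  shows "irreducible f"
proof (rule irreducibleI)
  show nz: "f \<noteq> 0"
    using assms(1) by auto
  then show "\<not> is_unit f"
    using assms(1) by (simp add: is_unit_iff_degree)
  fix u v
  assume f: "f = u * v"
  then have "u \<noteq> 0" "v \<noteq> 0"
    using nz by auto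
  then have "degree f = degree u + degree v"
    by (simp add: f degree_mult_eq)
  moreover have "degree u = 0 \<or> degree f \<le> degree u"
    using assms(2)[of u] f by auto
  ultimately show "is_unit u \<or> is_unit v"
    using \<open>u \<noteq> 0\<close> \<open>v \<noteq> 0\<close> by (auto simp: is_unit_iff_degree)
qed

lemma degree_binomial: "n > 0 \<Longrightarrow> degree (monom 1 n - [:a:] :: 'a::field poly) = n"
  by (subst diff_conv_add_uminus, subst degree_add_eq_left) (auto simp: degree_monom_eq)

lemma map_poly_to_ac_mult: "map_poly to_ac (f * g) = map_poly to_ac f * map_poly to_ac g"
  by (simp add: poly_eq_iff coeff_map_poly coeff_mult to_ac_sum)

lemma root_of_factor:
  assumes "h dvd monom 1 n - [:a:]" "poly (map_poly to_ac h) \<alpha> = 0"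
  shows "\<alpha> ^ n = to_ac a"
proof -
  obtain g where g: "monom 1 n - [:a:] = h * g"
    using assms(1) by auto
  have "monom 1 n - [:to_ac a:] = map_poly to_ac (monom 1 n - [:a:])"
    by (auto simp: poly_eq_iff coeff_map_poly coeff_pCons split: nat.splits)
  also have "\<dots> = map_poly to_ac h * map_poly to_ac g"
    by (simp only: g map_poly_to_ac_mult)
  finally have "poly (monom 1 n - [:to_ac a:]) \<alpha> = 0"
    using assms(2) by (simp only: poly_mult mult_zero_left)
  then show ?thesis
    by (simp add: poly_monom)
qed

lemma factor_has_root:
  assumes "degree h > 0"
  obtains \<alpha> where "poly (map_poly to_ac h) \<alpha> = 0"
  using assms alg_closed_imp_poly_has_root[of "map_poly to_ac h"] by (auto simp: degree_map_poly)

lemma field_subset_range_to_ac: "field_subset (range to_ac)"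
proof
  fix x y :: "'a alg_closure"
  assume "x \<in> range to_ac" "y \<in> range to_ac"
  then obtain u v where "x = to_ac u" "y = to_ac v"
    by auto
  then show "x - y \<in> range to_ac" "x * y \<in> range to_ac" "inverse x \<in> range to_ac"
    by (metis rangeI to_ac_diff, metis rangeI to_ac_mult, metis rangeI to_ac_inverse)
qed (metis rangeI to_ac_1)

lemma map_poly_to_ac_over: "map_poly to_ac h \<in> polys_over (range to_ac)"
  by (simp add: polys_over_def coeff_map_poly)

text \<open>Apply \<open>degree_ge_of_radical\<close> to a root of \<open>h\<close> in the algebraic
  closure, with the embedded base field as \<open>F\<close>.\<close>

lemma degree_factor_of_binomial:
  fixes a \<zeta> :: "'a::field"
  assumes "prime p" "\<zeta> ^ p = 1" "\<zeta> \<noteq> 1" and a: "\<forall>b. b ^ p \<noteq> a"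
    and a2: "p = 2 \<longrightarrow> (\<forall>b. b ^ 2 \<noteq> - a)"
    and h: "h dvd monom 1 (p ^ s) - [:a:]" "degree h > 0"
  shows "p ^ s \<le> degree h"
proof -
  interpret field_subset "range (to_ac :: 'a \<Rightarrow> _)"
    by (rule field_subset_range_to_ac)
  obtain \<alpha> where \<alpha>: "poly (map_poly to_ac h) \<alpha> = 0"
    using h(2) by (rule factor_has_root)
  have "p ^ s \<le> degree (map_poly to_ac h)"
  proof (rule degree_ge_of_radical)
    show "to_ac \<zeta> ^ p = 1" "to_ac \<zeta> \<noteq> 1"
      using assms(2,3) by (metis to_ac_1 to_ac_power, metis to_ac_1 to_ac_eq_iff)
    show "\<forall>d\<in>range to_ac. d ^ p \<noteq> to_ac a"
      using a by (auto simp flip: to_ac_power)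
    show "p = 2 \<longrightarrow> 2 \<le> s \<longrightarrow> (\<forall>d\<in>range to_ac. d ^ 2 \<noteq> - to_ac a)"
      using a2 by (auto simp flip: to_ac_power to_ac_minus)
    show "map_poly to_ac h \<noteq> 0"
      using h(2) by (auto simp: map_poly_eq_0_iff)
  qed (use assms(1) map_poly_to_ac_over root_of_factor[OF h(1) \<alpha>] \<alpha> in auto)
  then show ?thesis
    by (simp add: degree_map_poly)
qed

lemma prod_mset_power_const:
  fixes c :: "'a::comm_monoid_mult"
  shows "(\<And>x. x \<in># A \<Longrightarrow> x ^ n = c) \<Longrightarrow> prod_mset A ^ n = c ^ size A"
  by (induction A) (simp_all add: power_mult_distrib)

lemma poly_prod_linear_factors_0:
  "poly (\<Prod>x\<in>#A. [:- x, 1:]) 0 = (- 1) ^ size A * prod_mset (A :: 'a::comm_ring_1 multiset)"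
  by (induction A) simp_all

text \<open>
  Up to sign, the constant term of \<open>h\<close> is a product of \<open>degree h\<close> many \<open>p ^ s\<close>-th roots of \<open>a\<close>. Hence
  \<open>a ^ degree h\<close> is a \<open>p ^ s\<close>-th power, and \<open>p\<close>-th roots in this relation are unique.
\<close>

lemma degree_factor_of_binomial_no_roots_of_unity:
  fixes a :: "'a::field"
  assumes p: "prime p" and unity: "\<And>z :: 'a. z ^ p = 1 \<Longrightarrow> z = 1" and a: "\<forall>b. b ^ p \<noteq> a"
    and h: "h dvd monom 1 (p ^ s) - [:a:]" "degree h > 0"
  shows "p ^ s \<le> degree h"
proof (rule ccontr)
  assume "\<not> ?thesis"
  then have lt: "degree h < p ^ s"
    by simp
  have "p > 0"
    using p prime_gt_0_nat by blast
  have "a \<noteq> 0"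
    using a \<open>p > 0\<close> by (metis zero_power)
  define H where "H = map_poly to_ac h"
  have H: "degree H = degree h" "H \<noteq> 0"
    using h(2) by (auto simp: H_def degree_map_poly map_poly_eq_0_iff)
  obtain A where A: "size A = degree h" "H = smult (lead_coeff H) (\<Prod>x\<in>#A. [:- x, 1:])"
    using alg_closed_imp_factorization[OF H(2)] H(1) by auto
  have "x ^ p ^ s = to_ac a" if "x \<in># A" for x
  proof (rule root_of_factor[OF h(1)])
    have "poly (\<Prod>x\<in>#A. [:- x, 1:]) x = 0"
      using that by (force simp: poly_prod_mset prod_mset_zero_iff)
    then show "poly (map_poly to_ac h) x = 0"
      using A(2) unfolding H_def by (metis mult_zero_right poly_smult)
  qed
  then have M: "prod_mset A ^ p ^ s = to_ac a ^ degree h"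
    using prod_mset_power_const[of A "p ^ s" "to_ac a"] A(1) by simp
  \<comment> \<open>\<open>m\<close> is the product of the roots of \<open>h\<close> with
    multiplicity, read off from the constant term; hence the product lies in the base field.\<close>
  define m where "m = coeff h 0 / lead_coeff h * (- 1) ^ degree h"
  have "coeff H 0 = lead_coeff H * ((- 1) ^ degree h * prod_mset A)"
    using arg_cong[OF A(2), of "\<lambda>q. poly q 0"]
    by (simp only: poly_smult poly_prod_linear_factors_0 A(1) flip: poly_0_coeff_0)
  moreover have "coeff H 0 = to_ac (coeff h 0)" "lead_coeff H = to_ac (lead_coeff h)"
    by (simp_all add: H_def coeff_map_poly degree_map_poly)
  moreover have "lead_coeff h \<noteq> 0"
    using h(2) by auto
  ultimately have "prod_mset A = to_ac m"
    by (simp add: m_def)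
  then have m: "m ^ p ^ s = a ^ degree h"
    using M by (metis to_ac_eq_iff to_ac_power)
  define v e where "v = multiplicity p (degree h)" and "e = degree h div p ^ v"
  have d: "degree h = e * p ^ v" and "\<not> p dvd e"
    using multiplicity_dvd[of p "degree h"] multiplicity_decompose[of "degree h" p] h(2) prime_gt_1_nat[OF p]
    by (simp_all add: v_def e_def)
  then have "e > 0"
    by (metis dvd_0_right gr0I)
  then have "p ^ v \<le> e * p ^ v"
    by simp
  then have "p ^ v < p ^ s"
    using lt unfolding d by (rule le_less_trans)
  then have "v < s"
    using p prime_gt_1_nat by (metis power_less_imp_less_exp)
  \<comment> \<open>\<open>y\<close> is a \<open>p ^ v\<close>-th root of unity, hence 1; this
    cancels \<open>p ^ v\<close> from both exponents in the relation between \<open>m\<close> and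
    \<open>a\<close>.\<close>
  define y where "y = m ^ p ^ (s - v) / a ^ e"
  have unity': "z = 1" if "z ^ p ^ j = 1" for z :: 'a and j
    using that
  proof (induction j arbitrary: z)
    case (Suc j)
    then have "(z ^ p) ^ p ^ j = 1"
      by (simp only: power_Suc power_mult)
    then show ?case
      using Suc.IH unity by blast
  qed simp
  have "p ^ (s - v) * p ^ v = p ^ s"
    using \<open>v < s\<close> by (simp flip: power_add)
  then have "y ^ p ^ v = m ^ p ^ s / a ^ degree h"
    by (simp only: y_def power_divide d flip: power_mult)
  also have "\<dots> = 1"
    unfolding m using \<open>a \<noteq> 0\<close> by simp
  finally have "y = 1"
    by (rule unity')
  then have "a ^ e = m ^ p ^ (s - v)"
    using \<open>a \<noteq> 0\<close> by (simp add: y_def)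
  moreover have "p ^ (s - v) = p ^ (s - v - 1) * p"
    using \<open>v < s\<close> power_minus_mult[of "s - v" p] by simp
  ultimately have ae: "a ^ e = (m ^ p ^ (s - v - 1)) ^ p"
    by (simp only: power_mult)
  \<comment> \<open>As \<open>e\<close> is prime to \<open>p\<close>, Bezout shows that
    \<open>a\<close> is a \<open>p\<close>-th power together with \<open>a ^ e\<close>.\<close>
  obtain x y where "e * x = p * y + 1"
    using bezout_nat[of e p] \<open>e > 0\<close> \<open>\<not> p dvd e\<close> p
    by (metis coprime_commute coprime_iff_gcd_eq_1 neq0_conv prime_imp_coprime)
  then have "(a ^ e) ^ x = (a ^ y) ^ p * a"
    by (simp add: mult.commute flip: power_mult)
  then have "((m ^ p ^ (s - v - 1)) ^ x / a ^ y) ^ p = a"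
    using \<open>a \<noteq> 0\<close> unfolding ae by (simp add: power_divide field_simps flip: power_mult)
  then show False
    using a by blast
qed

text \<open>
  With \<open>n = 2 ^ t\<close>, a root \<open>\<alpha>\<close> of \<open>h\<close> satisfies \<open>\<alpha> ^ n = J * b\<close> for a square root \<open>J\<close> of \<open>- 1\<close>. Over the
  field with \<open>J\<close> adjoined, \<open>\<alpha>\<close> has degree at least \<open>n\<close>; reducing \<open>h\<close> modulo \<open>x ^ n - J * b\<close> and separating
  the coefficients of \<open>1\<close> and \<open>J\<close> doubles this bound.
\<close>

lemma degree_factor_of_binomial_neg_square:
  fixes a b :: "'a::field"
  assumes i: "\<And>z :: 'a. z ^ 2 \<noteq> - 1" and a: "a = - (b ^ 2)" "a \<noteq> 0" "\<forall>c. a \<noteq> - 4 * c ^ 4"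
    and h: "h dvd monom 1 (2 ^ Suc t) - [:a:]" "degree h > 0"
  shows "2 ^ Suc t \<le> degree h"
proof (rule ccontr)
  assume "\<not> ?thesis"
  then have lt: "degree h < 2 * 2 ^ t"
    by simp
  define n :: nat where "n = 2 ^ t"
  obtain \<alpha> where \<alpha>: "poly (map_poly to_ac h) \<alpha> = 0"
    using h(2) by (rule factor_has_root)
  have "b \<noteq> 0"
    using a by auto
  define J where "J = \<alpha> ^ n / to_ac b"
  have \<alpha>n: "\<alpha> ^ n = J * to_ac b"
    using \<open>b \<noteq> 0\<close> by (simp add: J_def)
  have "\<alpha> ^ 2 ^ Suc t = to_ac a"
    by (rule root_of_factor[OF h(1) \<alpha>])
  then have "(\<alpha> ^ n) ^ 2 = - (to_ac b ^ 2)"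
    by (simp add: n_def a mult.commute[of 2] flip: power_mult)
  then have J: "J ^ 2 = - 1" 
    using \<open>b \<noteq> 0\<close> by (simp add: J_def power_divide)
  then have JJ: "J * J = - 1" "J * (J * x) = - x" for x
    by (simp_all add: power2_eq_square flip: mult.assoc)
  have indep: "u = 0 \<and> v = 0" if "to_ac u + J * to_ac v = 0" for u v
  proof -
    have "v = 0"
    proof (rule ccontr)
      assume "v \<noteq> 0"
      then have "J = to_ac (- u / v)"
        using that by (simp add: eq_neg_iff_add_eq_0 field_simps)
      then have "to_ac ((- u / v) ^ 2) = to_ac (- 1)"
        using J by simp
      then show False
        using i by (metis to_ac_eq_iff)
    qed
    then show ?thesis
      using that by simp
  qed
  define F where "F = {to_ac u + J * to_ac v |u v. True}"
  have F: "to_ac u + J * to_ac v \<in> F" for u v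
    by (auto simp: F_def)
  interpret field_subset F
  proof
    show "1 \<in> F"
      using F[of 1 0] by simp
    fix x y
    assume "x \<in> F" "y \<in> F"
    then obtain u v u' v' where x: "x = to_ac u + J * to_ac v" and y: "y = to_ac u' + J * to_ac v'"
      by (auto simp: F_def)
    show "x - y \<in> F"
      using F[of "u - u'" "v - v'"] by (simp add: x y algebra_simps)
    show "x * y \<in> F"
      using F[of "u * u' - v * v'" "u * v' + v * u'"] by (simp add: x y algebra_simps JJ)
    show "inverse x \<in> F"
    proof (cases "u = 0 \<and> v = 0")
      case True
      then show ?thesis
        using F[of 0 0] by (simp add: x)
    next
      case False
      \<comment> \<open>\<open>w\<close> is the norm of \<open>x\<close>; it is nonzero as -1 is not
        a square in the base field.\<close>
      define w where "w = u ^ 2 + v ^ 2"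
      have "w \<noteq> 0"
      proof
        assume "w = 0"
        then have "v \<noteq> 0"
          using False by (auto simp: w_def)
        then have "(u / v) ^ 2 = - 1"
          using \<open>w = 0\<close> by (simp add: w_def field_simps eq_neg_iff_add_eq_0)
        then show False
          using i by blast
      qed
      have "x * (to_ac u - J * to_ac v) = to_ac w"
        by (simp add: x w_def algebra_simps JJ power2_eq_square)
      then have "x * (to_ac (u / w) + J * to_ac (- v / w)) = 1"
        using \<open>w \<noteq> 0\<close> by (simp add: field_simps)
      then show ?thesis
        using F by (metis inverse_unique)
    qed
  qed
  \<comment> \<open>Comparing the two parts of \<open>d ^ 2 = J * to_ac e\<close> gives
    \<open>a = - 4 * u ^ 4\<close>. The choices \<open>b\<close> and \<open>- b\<close> for
    \<open>e\<close> serve the two power conditions of \<open>degree_ge_of_radical\<close>.\<close>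
  have nonsquare: "d ^ 2 \<noteq> J * to_ac e" if "d \<in> F" "e ^ 2 = b ^ 2" for d e
  proof
    assume "d ^ 2 = J * to_ac e"
    moreover obtain u v where d: "d = to_ac u + J * to_ac v"
      using \<open>d \<in> F\<close> by (auto simp: F_def)
    ultimately have "to_ac (u ^ 2 - v ^ 2) + J * to_ac (2 * u * v - e) = 0"
      by (simp add: power2_eq_square algebra_simps JJ)
    then have "u ^ 2 = v ^ 2" "e = 2 * u * v"
      using indep by fastforce+
    then have "b ^ 2 = 4 * u ^ 2 * v ^ 2"
      using that(2) by (simp add: power_mult_distrib)
    moreover have "u ^ 4 = u ^ 2 * u ^ 2"
      by (simp add: power4_eq_xxxx power2_eq_square mult.assoc)
    ultimately have "a = - 4 * u ^ 4"
      using \<open>u ^ 2 = v ^ 2\<close> by (simp add: a(1) mult.assoc)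
    then show False
      using a(3) by blast
  qed
  \<comment> \<open>\<open>g\<close> is \<open>h\<close> with \<open>x ^ n\<close> replaced by
    \<open>J * to_ac b\<close>, so it also vanishes at \<open>\<alpha>\<close>. Two blocks of
    \<open>n\<close> coefficients suffice because \<open>degree h < 2 * n\<close>.\<close>
  define g where "g = (\<Sum>i<n. monom (to_ac (coeff h i) + J * to_ac (b * coeff h (n + i))) i)"
  have g_coeff: "coeff g k = (if k < n then to_ac (coeff h k) + J * to_ac (b * coeff h (n + k)) else 0)" for k
    by (simp add: g_def coeff_sum)
  have "g = 0"
  proof (rule ccontr)
    assume "g \<noteq> 0"
    have "2 ^ t \<le> degree g"
    proof (rule degree_ge_of_radical)
      show "prime (2::nat)"
        by simp
      show "- 1 \<in> F"
        using one_closed by (rule uminus_closed)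
      show "(- 1 :: 'a alg_closure) ^ 2 = 1"
        by simp
      show "- 1 \<noteq> (1 :: 'a alg_closure)"
        using i[of 1] by (metis power_one to_ac_1 to_ac_eq_iff to_ac_minus)
      show "J * to_ac b \<in> F"
        using F[of 0 b] by simp
      show "\<forall>d\<in>F. d ^ 2 \<noteq> J * to_ac b"
        using nonsquare by blast
      show "2 = 2 \<longrightarrow> 2 \<le> t \<longrightarrow> (\<forall>d\<in>F. d ^ 2 \<noteq> - (J * to_ac b))"
        using nonsquare[of _ "- b"] by simp
      show "\<alpha> ^ 2 ^ t = J * to_ac b"
        using \<alpha>n by (simp add: n_def)
      show "g \<in> polys_over F"
        using F zero_closed by (simp add: polys_over_def g_coeff del: to_ac_mult)
      show "g \<noteq> 0"
        by fact
      let ?c = "\<lambda>i. to_ac (coeff h i) * \<alpha> ^ i"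
      have "poly g \<alpha> = (\<Sum>i<n. ?c i) + (\<Sum>i<n. ?c (n + i))"
        by (simp add: g_def poly_sum poly_monom sum.distrib power_add \<alpha>n algebra_simps)
      also have "(\<Sum>i<n. ?c (n + i)) = sum ?c {n..<2 * n}"
        using sum.shift_bounds_nat_ivl[of ?c 0 n n] by (simp add: atLeast0LessThan add.commute mult_2)
      also have "(\<Sum>i<n. ?c i) + sum ?c {n..<2 * n} = sum ?c {..<2 * n}"
        using sum.atLeastLessThan_concat[of 0 n "2 * n" ?c] by (simp add: atLeast0LessThan)
      also have "\<dots> = sum ?c {..degree h}"
        using lt by (intro sum.mono_neutral_right) (auto simp: n_def coeff_eq_0)
      also have "\<dots> = 0"
        using \<alpha> by (simp add: poly_altdef degree_map_poly coeff_map_poly)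
      finally show "poly g \<alpha> = 0" .
    qed
    then have "coeff g (degree g) = 0"
      by (simp add: g_coeff n_def)
    then show False
      using \<open>g \<noteq> 0\<close> by simp
  qed
  \<comment> \<open>By \<open>indep\<close>, the vanishing of \<open>g\<close> kills both blocks of
    coefficients of \<open>h\<close>.\<close>
  have "coeff h k = 0" for k
  proof (cases "k < n")
    case True
    then have "to_ac (coeff h k) + J * to_ac (b * coeff h (n + k)) = 0"
      using g_coeff[of k] \<open>g = 0\<close> by simp
    then show ?thesis
      using indep by blast
  next
    case False
    show ?thesis
    proof (cases "k < 2 * n")
      case True
      then have "k - n < n" "n + (k - n) = k"
        using False by auto
      then have "to_ac (coeff h (k - n)) + J * to_ac (b * coeff h k) = 0"
        using g_coeff[of "k - n"] \<open>g = 0\<close> by simp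
      then show ?thesis
        using indep \<open>b \<noteq> 0\<close> by (meson mult_eq_0_iff)
    next
      case False
      then show ?thesis
        using lt by (intro coeff_eq_0) (simp add: n_def)
    qed
  qed
  then have "h = 0"
    by (simp add: poly_eq_iff)
  then show False
    using h(2) by simp
qed

text \<open>The sufficient half of Capelli's criterion for prime power exponents. The three degree
  bounds above treat the cases of no nontrivial \<open>p\<close>-th root of unity, of
  \<open>p = 2\<close> with \<open>- a\<close> a square, and the remaining one.\<close>

theorem irreducible_binomial:
  fixes a :: "'a::field"
  assumes p: "prime p" and a: "\<forall>b. b ^ p \<noteq> a" and a2: "p = 2 \<longrightarrow> (\<forall>c. a \<noteq> - 4 * c ^ 4)"
    and char: "p = 2 \<longrightarrow> (2 :: 'a) \<noteq> 0"
  shows "irreducible (monom 1 (p ^ s) - [:a:])"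
proof (rule irreducible_if_no_small_factor)
  have "p ^ s > 0"
    using p prime_gt_0_nat by simp
  then have deg: "degree (monom 1 (p ^ s) - [:a:]) = p ^ s"
    by (rule degree_binomial)
  then show "degree (monom 1 (p ^ s) - [:a:]) > 0"
    using \<open>p ^ s > 0\<close> by simp
  fix h
  assume h: "h dvd monom 1 (p ^ s) - [:a:]" "degree h > 0"
  have "a \<noteq> 0"
    using a p by (metis zero_power prime_gt_0_nat)
  have "p ^ s \<le> degree h"
  proof (cases "\<exists>\<zeta> :: 'a. \<zeta> ^ p = 1 \<and> \<zeta> \<noteq> 1")
    case False
    then show ?thesis
      using degree_factor_of_binomial_no_roots_of_unity[OF p _ a h] by blast
  next
    case True
    then obtain \<zeta> :: 'a where \<zeta>: "\<zeta> ^ p = 1" "\<zeta> \<noteq> 1"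
      by blast
    show ?thesis
    proof (cases "p = 2 \<and> (\<exists>b. b ^ 2 = - a)")
      case False
      then show ?thesis
        using degree_factor_of_binomial[OF p \<zeta> a _ h] by blast
    next
      case True
      then obtain b where "p = 2" and b: "a = - (b ^ 2)"
        by (metis minus_minus)
      \<comment> \<open>A square root of -1 would make \<open>a\<close> a square along with
        \<open>- a\<close>.\<close>
      have i: "z ^ 2 \<noteq> - 1" for z :: 'a
        using a b \<open>p = 2\<close> by (metis mult_minus1 power_mult_distrib)
      show ?thesis
      proof (cases s)
        case (Suc t)
        then show ?thesis
          using degree_factor_of_binomial_neg_square[OF i b \<open>a \<noteq> 0\<close>] a2 h \<open>p = 2\<close> by simp
      qed (use h in simp)
    qed
  qed
  then show "degree (monom 1 (p ^ s) - [:a:]) \<le> degree h"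
    by (simp only: deg)
qed

section \<open>The fixed field of the automorphism group\<close>

text \<open>Subtracting \<open>\<sigma>' y\<close> times the relation at \<open>x\<close> from the
  relation at \<open>y * x\<close> removes \<open>\<sigma>'\<close>, and induction applies to the
  shorter relation.\<close>

lemma dedekind_independence:
  fixes S :: "('a::comm_monoid_mult \<Rightarrow> 'b::field) set"
  assumes "finite S" "\<And>\<sigma>. \<sigma> \<in> S \<Longrightarrow> \<sigma> 1 = 1" "\<And>\<sigma> x y. \<sigma> \<in> S \<Longrightarrow> \<sigma> (x * y) = \<sigma> x * \<sigma> y"
    and "\<And>x. (\<Sum>\<sigma>\<in>S. u \<sigma> * \<sigma> x) = 0" "\<sigma> \<in> S"
  shows "u \<sigma> = 0"
  using assms
proof (induction S arbitrary: u \<sigma> rule: finite_induct)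
  case (insert \<sigma>' S)
  have "u \<rho> = 0" if "\<rho> \<in> S" for \<rho>
  proof -
    have "\<rho> \<noteq> \<sigma>'"
      using that insert.hyps by auto
    then obtain y where y: "\<rho> y \<noteq> \<sigma>' y"
      by blast
    have "(\<Sum>\<sigma>\<in>S. u \<sigma> * (\<sigma> y - \<sigma>' y) * \<sigma> x) = 0" for x
    proof -
      have "(\<Sum>\<sigma>\<in>S. u \<sigma> * (\<sigma> y - \<sigma>' y) * \<sigma> x) =
          (\<Sum>\<sigma>\<in>S. u \<sigma> * \<sigma> (y * x)) - \<sigma>' y * (\<Sum>\<sigma>\<in>S. u \<sigma> * \<sigma> x)"
        using insert.prems(2) by (auto simp: sum_distrib_left algebra_simps simp flip: sum_subtractf intro!: sum.cong)
      also have "\<dots> = - (u \<sigma>' * \<sigma>' (y * x)) + \<sigma>' y * (u \<sigma>' * \<sigma>' x)"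
        using insert.prems(3)[of x] insert.prems(3)[of "y * x"] insert.hyps
        by (simp add: add_eq_0_iff2)
      also have "\<dots> = 0"
        using insert.prems(2)[of \<sigma>' y x] by simp
      finally show ?thesis .
    qed
    then have "u \<rho> * (\<rho> y - \<sigma>' y) = 0"
      using insert.IH[of "\<lambda>\<sigma>. u \<sigma> * (\<sigma> y - \<sigma>' y)" \<rho>] insert.prems(1,2) that by blast
    then show ?thesis
      using y by simp
  qed
  moreover from this have "(\<Sum>\<sigma>\<in>S. u \<sigma> * \<sigma> 1) = 0"
    by (intro sum.neutral) simp
  then have "u \<sigma>' * \<sigma>' 1 = 0"
    using insert.prems(3)[of 1] insert.hyps by simp
  then have "u \<sigma>' = 0"
    using insert.prems(1)[of \<sigma>'] by simp
  ultimately show ?case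
    using insert.prems(4) by auto
qed simp

lemma vector_space_ext_scale: "field_emb \<phi> \<Longrightarrow> vector_space (ext_scale \<phi>)"
  by unfold_locales (auto simp: field_emb_def ext_scale_def algebra_simps)

lemma vector_space_fun: "vector_space (\<lambda>(c::'b::field) (f::'a \<Rightarrow> 'b) x. c * f x)"
  by unfold_locales (auto simp: algebra_simps)

lemma sum_fun_apply: "(\<Sum>i\<in>A. f i) x = (\<Sum>i\<in>A. f i x)"
  by (induction A rule: infinite_finite_induct) simp_all

text \<open>
  If \<open>u\<close> were not in the base field, extend \<open>{u, 1}\<close> to a basis. As the automorphisms fix \<open>u\<close>, they all lie
  in the span of one function fewer than the degree, contradicting Dedekind's independence of characters.
\<close>

lemma fixed_field_of_ext_auts:
  fixes \<phi> :: "'k::field \<Rightarrow> 'K::field"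
  assumes emb: "field_emb \<phi>" and fin: "ext_finite \<phi>" and galois: "card (ext_auts \<phi>) = ext_degree \<phi>"
    and u: "\<And>\<sigma>. \<sigma> \<in> ext_auts \<phi> \<Longrightarrow> \<sigma> u = u"
  shows "u \<in> range \<phi>"
proof (rule ccontr)
  assume u_notin: "u \<notin> range \<phi>"
  interpret V: vector_space "ext_scale \<phi>"
    using emb by (rule vector_space_ext_scale)
  interpret W: vector_space "\<lambda>(c::'K) (f::'K \<Rightarrow> 'K) x. c * f x"
    by (rule vector_space_fun)
  have \<phi>: "\<phi> 1 = 1"
    using emb by (simp add: field_emb_def)
  have "u \<notin> V.span {1}"
    using u_notin by (auto simp: V.span_singleton ext_scale_def)
  moreover have "1 \<noteq> u"
    using u_notin \<phi> by (metis rangeI)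
  ultimately have "V.independent {u, 1}"
    by (simp add: V.independent_insert)
  define B where "B = V.extend_basis {u, 1}"
  have B: "V.independent B" "{u, 1} \<subseteq> B" "V.span B = UNIV"
    using V.independent_extend_basis V.extend_basis_superset V.span_extend_basis
      \<open>V.independent {u, 1}\<close> by (auto simp: B_def)
  have "finite B"
    using fin V.independent_span_bound[of _ B] B(1) by (auto simp: ext_finite_def)
  have "ext_degree \<phi> = card B"
    using V.dim_eq_card[of B UNIV] B by (simp add: ext_degree_def)
  define e where "e b x = \<phi> (V.representation B x b)" for b x
  define C where "C = B - {u, 1}"
  have "finite C" "card B = card C + 2"
    using \<open>finite B\<close> B(2) \<open>1 \<noteq> u\<close> card_Diff_subset[of "{u, 1}" B] card_mono[of B "{u, 1}"]
    by (auto simp: C_def)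
  \<comment> \<open>All automorphisms fix 1 and \<open>u\<close>, so they agree on the span of these
    two; the two coordinate functions can therefore be merged into one.\<close>
  define T where "T = insert (\<lambda>x. e 1 x + u * e u x) (e ` C)"
  have "finite T" "card T < card B"
    using \<open>finite C\<close> \<open>card B = card C + 2\<close> card_image_le[of C e] card_insert_le_m1[of _ "e ` C"]
    by (auto simp: T_def card_insert_if)
  have aut: "\<sigma> (x + y) = \<sigma> x + \<sigma> y" "\<sigma> (x * y) = \<sigma> x * \<sigma> y" "\<sigma> (\<phi> a) = \<phi> a"
    if "\<sigma> \<in> ext_auts \<phi>" for \<sigma> x y a
    using that by (auto simp: ext_auts_def)
  have "\<sigma> \<in> W.span T" if \<sigma>: "\<sigma> \<in> ext_auts \<phi>" for \<sigma>
  proof -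
    have "\<sigma> 0 = 0"
      using aut(1)[OF \<sigma>, of 0 0] by (metis add.right_neutral add_left_cancel)
    then have \<sigma>_sum: "\<sigma> (sum f A) = (\<Sum>x\<in>A. \<sigma> (f x))" for f :: "'K \<Rightarrow> 'K" and A
      using aut(1)[OF \<sigma>] by (induction A rule: infinite_finite_induct) auto
    have eq: "\<sigma> x = 1 * (e 1 x + u * e u x) + (\<Sum>b\<in>C. \<sigma> b * e b x)"
 for x
    proof -
      have "x = (\<Sum>b\<in>B. ext_scale \<phi> (V.representation B x b) b)"
        using V.sum_representation_eq[OF B(1) _ \<open>finite B\<close> order.refl, of x] B(3) by simp
      then have "\<sigma> x = \<sigma> (\<Sum>b\<in>B. ext_scale \<phi> (V.representation B x b) b)"
        by (rule arg_cong)
      also have "\<dots> = (\<Sum>b\<in>B. e b x * \<sigma> b)"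
        by (simp add: \<sigma>_sum aut(2,3)[OF \<sigma>] e_def ext_scale_def)
      also have "\<dots> = (\<Sum>b\<in>{u, 1}. e b x * \<sigma> b) + (\<Sum>b\<in>C. e b x * \<sigma> b)"
        using sum.subset_diff[OF B(2) \<open>finite B\<close>, of "\<lambda>b. e b x * \<sigma> b"]
        by (simp only: C_def add.commute)
      also have "\<dots> = e 1 x + u * e u x + (\<Sum>b\<in>C. \<sigma> b * e b x)"
        using \<open>1 \<noteq> u\<close> u[OF \<sigma>] aut(3)[OF \<sigma>, of 1] \<phi> by (simp add: mult.commute)
      finally show ?thesis
        by simp
    qed
    have "\<sigma> = (\<lambda>x. 1 * (e 1 x + u * e u x)) + (\<Sum>b\<in>C. (\<lambda>x. \<sigma> b * e b x))"
      by (rule ext, unfold plus_fun_apply sum_fun_apply) (rule eq)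
    also have "\<dots> \<in> W.span T"
      by (intro W.span_add W.span_sum W.span_scale W.span_base) (auto simp: T_def)
    finally show ?thesis .
  qed
  moreover have "W.independent (ext_auts \<phi>)"
    unfolding W.independent_explicit_finite_subsets
  proof (intro allI impI ballI)
    fix S v \<sigma>
    assume S: "S \<subseteq> ext_auts \<phi>" "finite S" and sum: "(\<Sum>\<sigma>\<in>S. (\<lambda>x. v \<sigma> * \<sigma> x)) = 0" and "\<sigma> \<in> S"
    show "v \<sigma> = 0"
    proof (rule dedekind_independence[OF S(2) _ _ _ \<open>\<sigma> \<in> S\<close>])
      show "(\<Sum>\<sigma>\<in>S. v \<sigma> * \<sigma> x) = 0" for x
        using fun_cong[OF sum, of x] by (simp add: sum_fun_apply)
    qed (use S(1) aut \<phi> in \<open>metis subsetD\<close>)+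
  qed
  ultimately have "card (ext_auts \<phi>) \<le> card T"
    using W.independent_span_bound[OF \<open>finite T\<close>] by blast
  then show False
    using \<open>card T < card B\<close> galois \<open>ext_degree \<phi> = card B\<close> by simp
qed

section \<open>Radicals in cyclic extensions\<close>

locale field_embedding =
  fixes f :: "'a::field \<Rightarrow> 'b::field"
  assumes one: "f 1 = 1" and add: "f (x + y) = f x + f y" and mult: "f (x * y) = f x * f y"
begin

lemma zero: "f 0 = 0"
  using add[of 0 0] by (metis add.right_neutral add_left_cancel)

lemma uminus: "f (- x) = - f x"
  using add[of x "- x"] by (simp add: zero add_eq_0_iff)

lemma power: "f (x ^ n) = f x ^ n"
  by (induction n) (simp_all add: one mult)

lemma eq_0_iff: "f x = 0 \<longleftrightarrow> x = 0"
proof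
  assume "f x = 0"
  show "x = 0"
  proof (rule ccontr)
    assume "x \<noteq> 0"
    then have "f x * f (inverse x) = 1"
      by (simp add: one flip: mult)
    then show False
      using \<open>f x = 0\<close> by simp
  qed
qed (simp add: zero)

lemma diff: "f (x - y) = f x - f y"
  using add[of x "- y"] by (simp add: uminus)

lemma eq_iff: "f x = f y \<longleftrightarrow> x = y"
  using eq_0_iff[of "x - y"] by (simp add: diff)

lemma divide: "f (x / y) = f x / f y"
proof (cases "y = 0")
  case False
  then have "f (x / y) * f y = f x"
    by (simp flip: mult)
  then show ?thesis
    using False by (simp add: eq_0_iff field_simps)
qed (simp add: zero)

end

text \<open>The \<open>p\<close> distinct powers of \<open>z\<close> exhaust the roots of
  \<open>x ^ p - 1\<close>, of which there are at most \<open>p\<close>.\<close>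

lemma root_of_unity_is_power:
  fixes z w :: "'a::field"
  assumes p: "prime p" and z: "z ^ p = 1" "z \<noteq> 1" and w: "w ^ p = 1"
  obtains j where "w = z ^ j"
proof -
  have "p > 0"
    using p by (rule prime_gt_0_nat)
  have "z \<noteq> 0"
    using z \<open>p > 0\<close> by (auto simp: power_0_left)
  have inj: "i = j" if "z ^ i = z ^ j" "i \<le> j" "j < p" for i j
  proof -
    have "z ^ i * z ^ (j - i) = z ^ (i + (j - i))"
      by (rule power_add[symmetric])
    then have "z ^ i * z ^ (j - i) = z ^ i * 1"
      using that by simp
    then have "p dvd j - i"
      using \<open>z \<noteq> 0\<close> root_of_unity_power_eq_1_iff[OF p z] by (subst (asm) mult_left_cancel) auto
    then show ?thesis
      using that by (metis diff_is_0_eq dvd_imp_le le_antisym less_imp_diff_less not_gr_zero not_less)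
  qed
  have "inj_on (\<lambda>i. z ^ i) {..<p}"
    by (rule inj_onI) (metis inj lessThan_iff nle_le)
  then have "card ((\<lambda>i. z ^ i) ` {..<p}) = p"
    by (simp add: card_image)
  moreover define R where "R = {x :: 'a. poly (monom 1 p - [:1:]) x = 0}"
  have deg: "degree (monom 1 p - [:1 :: 'a:]) = p"
    using \<open>p > 0\<close> by (rule degree_binomial)
  then have "monom 1 p - [:1 :: 'a:] \<noteq> 0"
    using \<open>p > 0\<close> by (metis degree_0 less_irrefl)
  then have "finite R" "card R \<le> p"
    unfolding R_def using poly_roots_finite card_poly_roots_bound deg by metis+
  moreover have "(z ^ i) ^ p = 1" for i
    using z(1) by (metis mult.commute power_mult power_one)
  then have "(\<lambda>i. z ^ i) ` {..<p} \<subseteq> R"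
    by (auto simp: R_def poly_monom)
  ultimately have "(\<lambda>i. z ^ i) ` {..<p} = R"
    using card_seteq by metis
  moreover have "w \<in> R"
    using w by (simp add: R_def poly_monom)
  ultimately show ?thesis
    using that by blast
qed

text \<open>What is kept of the cyclic Galois group: the fixed field of its generator
  \<open>\<tau>\<close> is exactly the base field.\<close>

locale cyclic_extension = \<phi>: field_embedding \<phi> + \<tau>: field_embedding \<tau>
  for \<phi> :: "'k::field \<Rightarrow> 'K::field" and \<tau> :: "'K \<Rightarrow> 'K" +
  assumes fixes_base: "\<tau> (\<phi> a) = \<phi> a"
    and fixed_in_base: "\<tau> x = x \<Longrightarrow> x \<in> range \<phi>"
begin

lemma fixed_root:
  assumes "\<alpha> ^ n = \<phi> a" "\<tau> \<alpha> = \<alpha>"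
  obtains b where "\<alpha> = \<phi> b" "b ^ n = a"
proof -
  obtain b where "\<alpha> = \<phi> b"
    using fixed_in_base[OF assms(2)] by auto
  then show ?thesis
    using that[of b] assms(1) by (simp add: \<phi>.eq_iff flip: \<phi>.power)
qed

lemma root_quotient_power:
  assumes "\<alpha> ^ n = \<phi> a" "a \<noteq> 0"
  shows "(\<tau> \<alpha> / \<alpha>) ^ n = 1"
  using assms \<phi>.eq_0_iff[of a] by (simp add: power_divide fixes_base flip: \<tau>.power)

text \<open>If every \<open>a\<close> had a \<open>p\<close>-th root \<open>\<alpha>\<close> in
  \<open>'K\<close>, all quotients \<open>\<tau> \<alpha> / \<alpha>\<close> would be powers of a
  single one, coming from a root \<open>\<gamma>\<close> of some \<open>g\<close>. Dividing
  \<open>\<alpha>\<close> by a power of \<open>\<gamma>\<close> gives an element fixed by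
  \<open>\<tau>\<close>, so \<open>g\<close> would generate the quotient group.\<close>

lemma nonpower_if_noncyclic:
  assumes p: "prime p" and noncyclic: "\<not> pth_power_quotient_cyclic p TYPE('k)"
  shows "\<exists>a. a \<noteq> 0 \<and> (\<forall>\<beta>. \<beta> ^ p \<noteq> \<phi> a)"
proof (rule ccontr)
  assume "\<not> ?thesis"
  then have root: "\<exists>\<beta>. \<beta> ^ p = \<phi> a" if "a \<noteq> 0" for a
    using that by blast
  have nz: "\<alpha> \<noteq> 0" if "\<alpha> ^ p = \<phi> a" "a \<noteq> 0" for \<alpha> a
    using that p by (metis \<phi>.eq_0_iff zero_power prime_gt_0_nat)
  obtain g \<gamma> where g: "g \<noteq> 0" "\<gamma> ^ p = \<phi> g" "\<And>a \<alpha>. a \<noteq> 0 \<Longrightarrow> \<alpha> ^ p = \<phi> a \<Longrightarrow> \<exists>j. \<tau> \<alpha> / \<alpha> = (\<tau> \<gamma> / \<gamma>) ^ j"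
  \<comment> \<open>A nontrivial quotient generates all \<open>p\<close>-th roots of unity; if there
    is none, \<open>g = 1\<close> will do.\<close>
  proof (cases "\<exists>g \<gamma>. g \<noteq> 0 \<and> \<gamma> ^ p = \<phi> g \<and> \<tau> \<gamma> / \<gamma> \<noteq> 1")
    case True
    then show ?thesis
      using that root_of_unity_is_power[OF p] root_quotient_power by metis
  next
    case False
    then show ?thesis
      using that[of 1 1] by (force simp: \<phi>.one intro: exI[of _ 0])
  qed
  have "\<exists>n b. b \<noteq> 0 \<and> a = g ^ n * b ^ p" if "a \<noteq> 0" for a
  proof -
    obtain \<alpha> where \<alpha>: "\<alpha> ^ p = \<phi> a"
      using root \<open>a \<noteq> 0\<close> by blast
    then obtain j where j: "\<tau> \<alpha> / \<alpha> = (\<tau> \<gamma> / \<gamma>) ^ j"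
      using g(3)[OF \<open>a \<noteq> 0\<close>] by blast
    have "(\<alpha> / \<gamma> ^ j) ^ p = \<phi> (a / g ^ j)"
      by (simp add: power_divide \<alpha> \<phi>.divide \<phi>.power g(2)[symmetric] mult.commute flip: power_mult)
    moreover have "\<tau> (\<alpha> / \<gamma> ^ j) = \<alpha> / \<gamma> ^ j"
      using j nz[OF \<alpha> that] nz[OF g(2,1)] \<tau>.eq_0_iff[of \<gamma>]
      by (simp add: \<tau>.divide \<tau>.power field_simps)
    ultimately obtain b where "b ^ p = a / g ^ j"
      by (rule fixed_root)
    then show ?thesis
      using that g(1) p by (intro exI[of _ j] exI[of _ b]) (auto simp: power_0_left prime_gt_0_nat)
  qed
  then have "pth_power_quotient_cyclic p TYPE('k)"
    using g(1) by (auto simp: pth_power_quotient_cyclic_def)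
  then show False
    using noncyclic by contradiction
qed

text \<open>A root \<open>\<alpha>\<close> yields a nontrivial root of unity \<open>\<zeta>\<close>.
  If \<open>\<tau>\<close> fixed \<open>\<zeta>\<close>, all \<open>p\<close>-th roots of unity
  would lie in the base field; if not, \<open>\<tau>\<close> fixes some
  \<open>\<zeta> ^ j * \<alpha>\<close>, and \<open>a\<close> is a \<open>p\<close>-th power
  there.\<close>

lemma nonpower_if_no_roots_of_unity:
  assumes p: "prime p" and unity: "\<not> roots_of_unity_in p TYPE('k)" and a: "a \<noteq> 0" "\<forall>b. b ^ p \<noteq> a"
  shows "\<alpha> ^ p \<noteq> \<phi> a"
proof
  assume \<alpha>: "\<alpha> ^ p = \<phi> a"
  have "p > 0"
    using p by (rule prime_gt_0_nat)
  have "\<alpha> \<noteq> 0"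
    using \<alpha> a(1) \<phi>.eq_0_iff[of a] \<open>p > 0\<close> by (auto simp: power_0_left)
  define \<zeta> where "\<zeta> = \<tau> \<alpha> / \<alpha>"
  have \<tau>\<alpha>: "\<tau> \<alpha> = \<zeta> * \<alpha>"
    using \<open>\<alpha> \<noteq> 0\<close> by (simp add: \<zeta>_def)
  have "\<tau> \<alpha> \<noteq> \<alpha>"
    using fixed_root[OF \<alpha>] a(2) by blast
  then have "\<zeta> \<noteq> 1"
    using \<tau>\<alpha> by auto
  moreover have "\<zeta> ^ p = 1"
    unfolding \<zeta>_def using \<alpha> a(1) by (rule root_quotient_power)
  ultimately have \<zeta>: "\<zeta> ^ p = 1" "\<zeta> \<noteq> 1"
    by simp_all
  have "\<tau> \<zeta> \<noteq> \<zeta>"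
  proof
    assume "\<tau> \<zeta> = \<zeta>"
    then obtain z where z: "\<zeta> = \<phi> z"
      using fixed_in_base by auto
    have "z ^ p = 1" "z \<noteq> 1"
      using \<zeta> by (auto simp: z \<phi>.one simp flip: \<phi>.eq_iff \<phi>.power)
    then have "to_ac z ^ p = 1" "to_ac z \<noteq> 1"
      by (metis to_ac_1 to_ac_power, metis to_ac_1 to_ac_eq_iff)
    then have "w \<in> range to_ac" if "w ^ p = 1" for w :: "'k alg_closure"
      using root_of_unity_is_power[OF p _ _ that, of "to_ac z"] by (metis rangeI to_ac_power)
    then have "roots_of_unity_in p TYPE('k)"
      by (simp add: roots_of_unity_in_def)
    then show False
      using unity by contradiction
  qed
  have "(\<tau> \<zeta>) ^ p = 1"
    using \<zeta>(1) by (simp add: \<tau>.one flip: \<tau>.power)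
  then obtain m where m: "\<tau> \<zeta> = \<zeta> ^ m"
    by (rule root_of_unity_is_power[OF p \<zeta>])
  have "m \<noteq> 0"
    using m \<zeta>(2) by (metis \<tau>.eq_iff \<tau>.one power_0)
  then obtain k where k: "m = Suc k"
    using not0_implies_Suc by blast
  have "\<not> p dvd k"
    using \<open>\<tau> \<zeta> \<noteq> \<zeta>\<close> m root_of_unity_power_eq_1_iff[OF p \<zeta>, of k] by (simp add: k)
  then obtain x y where xy: "k * x = p * y + 1"
    using bezout_nat[of k p] p
    by (metis coprime_commute coprime_iff_gcd_eq_1 dvd_0_right prime_imp_coprime)
  \<comment> \<open>\<open>\<tau>\<close> acts on the roots \<open>\<zeta> ^ j * \<alpha>\<close> as the affine map \<open>j \<mapsto> m * j + 1\<close>, which has a fixed point modulo \<open>p\<close>.\<close>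
  define j where "j = (p - 1) * x"
  \<comment> \<open>Modulo \<open>p\<close>, \<open>x\<close> inverts \<open>k\<close> and
    \<open>p - 1\<close> stands for -1, so \<open>j\<close> solves
    \<open>k * j + 1 = 0\<close>.\<close>
  have "k * j + 1 = (p - 1) * (k * x) + 1"
    by (simp add: j_def)
  also have "\<dots> = p * ((p - 1) * y + 1)"
    using \<open>p > 0\<close> unfolding xy by (cases p) (simp_all add: algebra_simps)
  finally have "\<zeta> ^ (k * j + 1) = 1"
    using \<zeta>(1) by (simp only: power_mult power_one)
  moreover have tau: "\<tau> (\<zeta> ^ j * \<alpha>) = \<zeta> ^ (k * j + 1) * (\<zeta> ^ j * \<alpha>)"
    by (simp add: \<tau>.mult \<tau>.power m k \<tau>\<alpha> power_mult_distrib mult_ac flip: power_mult)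
  ultimately have "\<tau> (\<zeta> ^ j * \<alpha>) = \<zeta> ^ j * \<alpha>"
    by (simp only: tau) simp
  moreover have "(\<zeta> ^ j * \<alpha>) ^ p = \<phi> a"
    using \<zeta>(1) \<alpha> by (simp add: power_mult_distrib mult.commute[of j] power_mult flip: power_mult)
      (simp add: power_mult mult.commute[of j])
  ultimately show False
    using a(2) fixed_root by metis
qed

text \<open>If -1 is a square in \<open>'K\<close>, so is every \<open>- 4 * \<gamma> ^ 4\<close>,
  and any nonsquare works. Otherwise take \<open>- d\<close> for a nonsquare \<open>d\<close> of the
  base field that becomes a square in \<open>'K\<close>; if there is no such \<open>d\<close>, take
  \<open>a\<close> with neither \<open>a\<close> nor \<open>- a\<close> a square.\<close>

lemma nonsquare_if_noncyclic:
  assumes noncyclic: "\<not> pth_power_quotient_cyclic 2 TYPE('k)"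
  shows "\<exists>a. a \<noteq> 0 \<and> (\<forall>\<beta>. \<beta> ^ 2 \<noteq> \<phi> a) \<and> (\<forall>\<gamma>. \<phi> a \<noteq> - 4 * \<gamma> ^ 4)"
proof (cases "\<exists>\<iota> :: 'K. \<iota> ^ 2 = - 1")
  case True
  then obtain \<iota> :: 'K where \<iota>: "\<iota> ^ 2 = - 1"
    by blast
  obtain a where a: "a \<noteq> 0" "\<forall>\<beta>. \<beta> ^ 2 \<noteq> \<phi> a"
    using nonpower_if_noncyclic[OF two_is_prime_nat noncyclic] by blast
  moreover have "- 4 * \<gamma> ^ 4 = (2 * \<iota> * \<gamma> ^ 2) ^ 2" for \<gamma>
    by (simp add: power_mult_distrib \<iota> flip: power_mult)
  ultimately show ?thesis
    by metis
next
  case no_i: False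
  show ?thesis
  proof (cases "\<exists>d \<delta>. d \<noteq> 0 \<and> \<delta> ^ 2 = \<phi> d \<and> (\<forall>e. e ^ 2 \<noteq> d)")
    case True
    then obtain d \<delta> where d: "d \<noteq> 0" "\<delta> ^ 2 = \<phi> d" "\<forall>e. e ^ 2 \<noteq> d"
      by blast
    have "\<delta> \<noteq> 0"
      using d(1,2) \<phi>.eq_0_iff[of d] by auto
    have "\<beta> ^ 2 \<noteq> \<phi> (- d)" for \<beta>
    proof
      assume "\<beta> ^ 2 = \<phi> (- d)"
      then have "(\<beta> / \<delta>) ^ 2 = - 1"
        using \<open>\<delta> \<noteq> 0\<close> by (simp add: power_divide \<phi>.uminus flip: d(2))
      then show False
        using no_i by blast
    qed
    \<comment> \<open>Here \<open>\<delta>\<close> would be \<open>2 * \<gamma> ^ 2\<close> up to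
      sign. As \<open>\<tau>\<close> negates \<open>\<delta>\<close>, the quotient
      \<open>\<tau> \<gamma> / \<gamma>\<close> would be a square root of -1.\<close>
    moreover have "\<phi> (- d) \<noteq> - 4 * \<gamma> ^ 4" for \<gamma>
    proof
      assume "\<phi> (- d) = - 4 * \<gamma> ^ 4"
      then have \<delta>2: "\<delta> ^ 2 = (2 * \<gamma> ^ 2) ^ 2"
        by (simp add: \<phi>.uminus d(2) power_mult_distrib flip: power_mult)
      then have "\<delta> = 2 * \<gamma> ^ 2 \<or> \<delta> = - (2 * \<gamma> ^ 2)"
        by (simp only: power2_eq_iff)
      moreover have "\<tau> \<delta> = - \<delta>"
      proof -
        have "(\<tau> \<delta>) ^ 2 = \<delta> ^ 2"
          by (simp add: d(2) fixes_base flip: \<tau>.power)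
        then show ?thesis
          using fixed_root[OF d(2)] d(3) by (metis power2_eq_iff)
      qed
      moreover have "\<tau> 2 = 2"
        using \<tau>.add[of 1 1] by (simp add: \<tau>.one)
      ultimately have "2 * (\<tau> \<gamma>) ^ 2 = 2 * - (\<gamma> ^ 2)"
        by (auto simp: \<tau>.mult \<tau>.power \<tau>.uminus) (metis minus_minus)
      moreover have "(2 :: 'K) \<noteq> 0"
        using \<delta>2 \<open>\<delta> \<noteq> 0\<close> by (metis mult_zero_left power_zero_numeral zero_eq_power2)
      ultimately have "(\<tau> \<gamma>) ^ 2 = - (\<gamma> ^ 2)"
        using mult_left_cancel by blast
      moreover have "\<gamma> \<noteq> 0"
        using \<delta>2 \<open>\<delta> \<noteq> 0\<close> by (metis mult_zero_right power_zero_numeral zero_eq_power2)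
      ultimately have "(\<tau> \<gamma> / \<gamma>) ^ 2 = - 1"
        by (simp add: power_divide)
      then show False
        using no_i by blast
    qed
    ultimately show ?thesis
      using d(1) by (intro exI[of _ "- d"]) auto
  next
    case False
    then have descend: "\<exists>e. e ^ 2 = d" if "d \<noteq> 0" "\<delta> ^ 2 = \<phi> d" for d \<delta>
      using that by blast
    \<comment> \<open>Noncyclicity is tested on the candidate generator -1.\<close>
    have "\<not> (\<forall>a :: 'k. a \<noteq> 0 \<longrightarrow> (\<exists>n::nat. \<exists>b. b \<noteq> 0 \<and> a = (- 1) ^ n * b ^ 2))"
      using noncyclic unfolding pth_power_quotient_cyclic_def
      by (metis neg_equal_0_iff_equal one_neq_zero)
    then obtain a :: 'k where a: "a \<noteq> 0" "\<not> (\<exists>n::nat. \<exists>b. b \<noteq> 0 \<and> a = (- 1) ^ n * b ^ 2)"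
      by blast
    have a': "e ^ 2 \<noteq> a" "e ^ 2 \<noteq> - a" for e
    proof -
      have "e = 0 \<or> a \<noteq> (- 1) ^ 0 * e ^ 2" "e = 0 \<or> a \<noteq> (- 1) ^ 1 * e ^ 2"
        using a(2) by blast+
      then show "e ^ 2 \<noteq> a" "e ^ 2 \<noteq> - a"
        using a(1) by auto
    qed
    have "\<beta> ^ 2 \<noteq> \<phi> a" for \<beta>
      using descend a(1) a'(1) by blast
    moreover have "\<phi> a \<noteq> - 4 * \<gamma> ^ 4" for \<gamma>
    proof
      assume "\<phi> a = - 4 * \<gamma> ^ 4"
      then have "(2 * \<gamma> ^ 2) ^ 2 = \<phi> (- a)"
        by (simp add: \<phi>.uminus power_mult_distrib flip: power_mult)
      then show False
        using descend[of "- a"] a(1) a'(2) by (metis neg_equal_0_iff_equal)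
    qed
    ultimately show ?thesis
      using a(1) by blast
  qed
qed

end

text \<open>An element fixed by the generator is fixed by all its powers, hence by every
  automorphism, so \<open>fixed_field_of_ext_auts\<close> applies.\<close>

lemma cyclic_extension_if_finite_cyclic_ext:
  assumes "finite_cyclic_ext \<phi>"
  obtains \<tau> where "cyclic_extension \<phi> \<tau>"
proof -
  obtain \<tau> where \<tau>: "\<tau> \<in> ext_auts \<phi>" "ext_auts \<phi> = range (\<lambda>n. \<tau> ^^ n)"
    and emb: "field_emb \<phi>" and fin: "ext_finite \<phi>" and card: "card (ext_auts \<phi>) = ext_degree \<phi>"
    using assms by (auto simp: finite_cyclic_ext_def)
  have "cyclic_extension \<phi> \<tau>"
  proof
    show "\<phi> 1 = 1" "\<phi> (x + y) = \<phi> x + \<phi> y" "\<phi> (x * y) = \<phi> x * \<phi> y" for x y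
      using emb by (auto simp: field_emb_def)
    show "\<tau> (x + y) = \<tau> x + \<tau> y" "\<tau> (x * y) = \<tau> x * \<tau> y" "\<tau> (\<phi> a) = \<phi> a" for x y a
      using \<tau>(1) by (auto simp: ext_auts_def)
    then show "\<tau> 1 = 1"
      using \<open>\<phi> 1 = 1\<close> by metis
    fix x
    assume "\<tau> x = x"
    then have "(\<tau> ^^ n) x = x" for n
      by (induction n) auto
    then show "x \<in> range \<phi>"
      using \<tau>(2) by (intro fixed_field_of_ext_auts[OF emb fin card]) auto
  qed
  then show ?thesis
    by (rule that)
qed

section \<open>Choice of the base field element for the given extension\<close>

theorem mainTheorem4:
  fixes p :: nat and \<phi> :: "'k::field \<Rightarrow> 'K::field" and s :: nat
  assumes "prime p"
    and "p \<noteq> CHAR('k)"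
    and "nontrivial_pth_powers p TYPE('k)"
    and "roots_of_unity_in p TYPE('k) \<longrightarrow> \<not> pth_power_quotient_cyclic p TYPE('k)"
    and "finite_cyclic_ext \<phi>"
  shows "\<exists>a::'k. a \<noteq> 0 \<and> irreducible (monom 1 (p ^ s) - [:\<phi> a:])"
proof -
  obtain \<tau> where "cyclic_extension \<phi> \<tau>"
    using assms(5) by (rule cyclic_extension_if_finite_cyclic_ext)
  then interpret cyclic_extension \<phi> \<tau> .
  have two: "(2 :: 'K) \<noteq> 0" if "p = 2"
  proof
    assume "(2 :: 'K) = 0"
    then have "\<phi> (of_nat 2) = 0"
      using \<phi>.add[of 1 1] by (simp add: \<phi>.one)
    then have "CHAR('k) dvd 2"
      by (simp only: \<phi>.eq_0_iff of_nat_eq_0_iff_char_dvd)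
    then show False
      using assms(2) \<open>p = 2\<close> CHAR_not_1[where ?'a = 'k] prime_nat_iff two_is_prime_nat
      by (metis One_nat_def)
  qed
  \<comment> \<open>The square roots of 1 are 1 and -1, so for \<open>p = 2\<close> the noncyclicity
    hypothesis is always available.\<close>
  have minus_one: "roots_of_unity_in p TYPE('k)" if "p = 2"
  proof -
    have "z = to_ac 1 \<or> z = to_ac (- 1)" if "z ^ 2 = 1" for z :: "'k alg_closure"
      using that by (simp add: power2_eq_1_iff)
    then show ?thesis
      using \<open>p = 2\<close> unfolding roots_of_unity_in_def by blast
  qed
  obtain a where a: "a \<noteq> 0" "\<forall>\<beta>. \<beta> ^ p \<noteq> \<phi> a" "p = 2 \<longrightarrow> (\<forall>\<gamma>. \<phi> a \<noteq> - 4 * \<gamma> ^ 4)"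
  proof (cases "roots_of_unity_in p TYPE('k)")
    case True
    then have noncyclic: "\<not> pth_power_quotient_cyclic p TYPE('k)"
      using assms(4) by blast
    show ?thesis
    proof (cases "p = 2")
      case True
      then show ?thesis
        using nonsquare_if_noncyclic noncyclic that by auto
    next
      case False
      then show ?thesis
        using nonpower_if_noncyclic[OF assms(1) noncyclic] that by blast
    qed
  next
    case False
    \<comment> \<open>By \<open>minus_one\<close>, \<open>p\<close> is not 2 here, so the condition
      on \<open>- 4 * \<gamma> ^ 4\<close> is vacuous.\<close>
    moreover obtain a :: 'k where "a \<noteq> 0" "\<forall>b. b ^ p \<noteq> a"
      using assms(3) unfolding nontrivial_pth_powers_def by metis
    ultimately show ?thesis
      using nonpower_if_no_roots_of_unity[OF assms(1)] minus_one that by blast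
  qed
  then have "irreducible (monom 1 (p ^ s) - [:\<phi> a:])"
    using two by (intro irreducible_binomial[OF assms(1)]) auto
  then show ?thesis
    using a(1) by blast
qed

end
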